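(* Let $f\in K[x_1,x_2,x_3]$ be a homogeneous polynomial of degree at least $2$ with zero Hessian. Then a variable can be eliminated from $f$ by a linear transformation of the variables; that is, there is $A\in \mathrm{GL}(3,K)$ such that $f(A^{-1}x)\in K[x_1,x_2]$, where $x=(x_1,x_2,x_3)$.
   Context: $K$ is an algebraically closed field of characteristic zero. A homogeneous polynomial $f\in K[x_1,\ldots,x_n]$ has zero Hessian if $\det\left(\frac{\partial^2 f}{\partial x_i\partial x_j}\right)_{1\le i,j\le n}=0$ as a polynomial. *)

theory Defs
  imports "HOL-Analysis.Analysis" "HOL-Library.Poly_Mapping"
begin

text \<open>
  Multivariate polynomials over a coefficient type, with variables indexed by a type: finitely
  supported functions from exponent vectors to coefficients, with the (convolution) ring structure
  of \<^theory>\<open>HOL-Library.Poly_Mapping\<close>. For \<open>K[x\<^sub>1,x\<^sub>2,x\<^sub>3]\<close> the index type is \<^typ>\<open>3\<close>, whose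
  elements are \<open>1\<close>, \<open>2\<close> and \<open>3\<close> (where \<open>3 = 0\<close>).
\<close>

type_synonym ('n, 'k) mvpoly = "('n \<Rightarrow>\<^sub>0 nat) \<Rightarrow>\<^sub>0 'k"

definition mv_const :: "'k::zero \<Rightarrow> ('n, 'k) mvpoly" where
  "mv_const c = Poly_Mapping.single 0 c"

definition mv_var :: "'n \<Rightarrow> ('n, 'k::zero_neq_one) mvpoly" where
  "mv_var i = Poly_Mapping.single (Poly_Mapping.single i 1) 1"

definition homogeneous :: "nat \<Rightarrow> ('n::finite, 'k::zero) mvpoly \<Rightarrow> bool" where
  "homogeneous d f \<longleftrightarrow>
     (\<forall>m\<in>Poly_Mapping.keys f. (\<Sum>i\<in>UNIV. Poly_Mapping.lookup m i) = d)"

text \<open>The variables occurring in a polynomial; \<open>f\<close> lies in the polynomial ring in the variables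
  \<open>x\<^sub>i\<close>, \<open>i \<in> I\<close>, iff \<open>mv_vars f \<subseteq> I\<close>.\<close>

definition mv_vars :: "('n, 'k::zero) mvpoly \<Rightarrow> 'n set" where
  "mv_vars f = (\<Union>m\<in>Poly_Mapping.keys f. Poly_Mapping.keys m)"

text \<open>Formal partial derivative. If \<open>x\<^sub>i\<close> does not occur in the monomial \<open>m\<close>, the truncated
  difference is harmless, since the coefficient then vanishes.\<close>

definition pdiff :: "'n \<Rightarrow> ('n, 'k::comm_semiring_1) mvpoly \<Rightarrow> ('n, 'k) mvpoly" where
  "pdiff i f = (\<Sum>m\<in>Poly_Mapping.keys f.
     Poly_Mapping.single (m - Poly_Mapping.single i 1)
       (of_nat (Poly_Mapping.lookup m i) * Poly_Mapping.lookup f m))"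

definition hessian :: "('n::finite, 'k::comm_semiring_1) mvpoly \<Rightarrow> ('n, 'k) mvpoly ^ 'n ^ 'n" where
  "hessian f = (\<chi> i j. pdiff i (pdiff j f))"

text \<open>Substitution of the polynomial \<open>\<sigma> $ i\<close> for each variable \<open>x\<^sub>i\<close>.\<close>

definition mv_subst ::
  "('n::finite, 'k::comm_semiring_1) mvpoly \<Rightarrow> ('n, 'k) mvpoly ^ 'n \<Rightarrow> ('n, 'k) mvpoly" where
  "mv_subst f \<sigma> = (\<Sum>m\<in>Poly_Mapping.keys f.
     mv_const (Poly_Mapping.lookup f m) * (\<Prod>i\<in>UNIV. \<sigma> $ i ^ Poly_Mapping.lookup m i))"

text \<open>\<open>lin_subst f B\<close> is \<open>f(B x)\<close>, where \<open>x\<close> is the column vector of variables.\<close>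

definition lin_subst ::
  "('n::finite, 'k::comm_semiring_1) mvpoly \<Rightarrow> 'k ^ 'n ^ 'n \<Rightarrow> ('n, 'k) mvpoly" where
  "lin_subst f B = mv_subst f (map_matrix mv_const B *v (\<chi> j. mv_var j))"

end

theory Submission
  imports Defs "HOL-Computational_Algebra.Polynomial"
begin

text \<open>
  Suppose that some principal \<open>2 \<times> 2\<close> minor \<open>D\<close> of the Hessian is a nonzero polynomial. At a point
  \<open>x\<close> with \<open>D(x) \<noteq> 0\<close> the kernel of the Hessian is spanned by one vector \<open>v\<close>, and the gradient is
  constant along the line \<open>x + tv\<close>: the vector \<open>y(t) = H(x + tv) v\<close> satisfies a linear differential
  equation with \<open>y(0) = 0\<close>. By homogeneity \<open>\<nabla>f(sx + tv) = s\<^sup>d\<^sup>-\<^sup>1 \<nabla>f(x)\<close>, so the gradient has a constant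
  direction on the plane spanned by \<open>x\<close> and \<open>v\<close>, apart from the line spanned by \<open>v\<close>, on which it
  vanishes. Two such planes in three-dimensional space meet in a nonzero vector; if the gradients at
  \<open>x\<close> and \<open>x'\<close> are not parallel, that vector has to be a multiple of both \<open>v\<close> and \<open>v'\<close>. Hence either
  all gradients are parallel, or all kernels are spanned by one and the same vector. In both cases the
  partial derivatives are linearly dependent over the field, and a linear transformation
  sending a coordinate vector to the vector of coefficients eliminates a variable. If all the
  principal \<open>2 \<times> 2\<close> minors vanish, then the Hessian has rank at most one and all gradients are parallel.
\<close>

section \<open>Polynomials as sums of monomials\<close>

lemma mvpoly_eq_sum_monomials:
  fixes f :: "('n, 'k::comm_monoid_add) mvpoly"
  shows "f = (\<Sum>m\<in>Poly_Mapping.keys f. Poly_Mapping.single m (Poly_Mapping.lookup f m))"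
  by (rule poly_mapping_eqI) (auto simp: lookup_sum lookup_single when_def in_keys_iff)

lemma mvpoly_induct [case_names single add]:
  fixes f :: "('n, 'k::comm_monoid_add) mvpoly"
  assumes single: "\<And>m c. P (Poly_Mapping.single m c)" and add: "\<And>f g. P f \<Longrightarrow> P g \<Longrightarrow> P (f + g)"
  shows "P f"
proof -
  have "P (\<Sum>m\<in>A. Poly_Mapping.single m (Poly_Mapping.lookup f m))" if "finite A" for A
    using that
  proof (induction A rule: finite_induct)
    case empty
    show ?case using single[of 0 0] by simp
  qed (simp add: single add)
  from this[of "Poly_Mapping.keys f"] show ?thesis
    by (simp flip: mvpoly_eq_sum_monomials)
qed

lemma mvpoly_sum_keys_superset:
  fixes f :: "('n, 'k::zero) mvpoly" and F :: "_ \<Rightarrow> 'k \<Rightarrow> 'r::comm_monoid_add"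
  assumes "\<And>m. F m 0 = 0" "finite A" "Poly_Mapping.keys f \<subseteq> A"
  shows "(\<Sum>m\<in>Poly_Mapping.keys f. F m (Poly_Mapping.lookup f m)) = (\<Sum>m\<in>A. F m (Poly_Mapping.lookup f m))"
  by (rule sum.mono_neutral_left) (use assms in \<open>auto simp: in_keys_iff\<close>)

text \<open>Cancellation may shrink the support of \<open>f + g\<close>, so all three sums are first
  extended to the union of the supports. This gives additivity of \<open>insertion\<close>.\<close>

lemma mvpoly_sum_keys_add:
  fixes f g :: "('n, 'k::comm_monoid_add) mvpoly" and F :: "_ \<Rightarrow> 'k \<Rightarrow> 'r::comm_monoid_add"
  assumes "\<And>m. F m 0 = 0" "\<And>m a b. F m (a + b) = F m a + F m b"
  shows "(\<Sum>m\<in>Poly_Mapping.keys (f + g). F m (Poly_Mapping.lookup (f + g) m)) =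
         (\<Sum>m\<in>Poly_Mapping.keys f. F m (Poly_Mapping.lookup f m)) +
         (\<Sum>m\<in>Poly_Mapping.keys g. F m (Poly_Mapping.lookup g m))"
proof -
  let ?A = "Poly_Mapping.keys f \<union> Poly_Mapping.keys g"
  note superset = mvpoly_sum_keys_superset[where F = F and A = ?A, OF assms(1)]
  show ?thesis
    using superset[of f] superset[of g] superset[of "f + g"] keys_add[of f g]
    by (simp add: assms(2) lookup_add sum.distrib)
qed

subsection \<open>Partial derivatives\<close>

text \<open>This coefficientwise form contains no truncated subtraction, so additivity, commutation
  and the vanishing criterion can be read off from it.\<close>

lemma lookup_pdiff:
  fixes f :: "('n, 'k::comm_semiring_1) mvpoly"
  shows "Poly_Mapping.lookup (pdiff i f) m =
     of_nat (Poly_Mapping.lookup m i + 1) * Poly_Mapping.lookup f (m + Poly_Mapping.single i 1)"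
proof -
  let ?e = "Poly_Mapping.single i (1::nat)"
  have *: "(of_nat (Poly_Mapping.lookup k i) * Poly_Mapping.lookup f k when k - ?e = m) =
      (of_nat (Poly_Mapping.lookup k i) * Poly_Mapping.lookup f k when k = m + ?e)" for k
  proof (cases "Poly_Mapping.lookup k i = 0")
    case False
    then have "k - ?e = m \<longleftrightarrow> k = m + ?e"
      by (auto simp: poly_mapping_eq_iff fun_eq_iff lookup_add lookup_minus lookup_single when_def)
    then show ?thesis by simp
  qed simp
  have "Poly_Mapping.lookup (pdiff i f) m =
     (\<Sum>k\<in>Poly_Mapping.keys f. of_nat (Poly_Mapping.lookup k i) * Poly_Mapping.lookup f k when k - ?e = m)"
    by (simp add: pdiff_def lookup_sum lookup_single)
  also have "\<dots> = of_nat (Poly_Mapping.lookup (m + ?e) i) * Poly_Mapping.lookup f (m + ?e)"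
    unfolding * by (auto simp: when_def in_keys_iff)
  finally show ?thesis by (simp add: lookup_add)
qed

lemma pdiff_single:
  "pdiff i (Poly_Mapping.single m c) =
     Poly_Mapping.single (m - Poly_Mapping.single i 1) (of_nat (Poly_Mapping.lookup m i) * c)"
  by (simp add: pdiff_def)

lemma pdiff_0 [simp]: "pdiff i 0 = 0"
  by (simp add: pdiff_def)

lemma pdiff_add: "pdiff i (f + g) = pdiff i f + pdiff i g"
  by (rule poly_mapping_eqI) (simp add: lookup_pdiff lookup_add distrib_left)

lemma pdiff_diff:
  fixes f g :: "('n, 'k::comm_ring_1) mvpoly"
  shows "pdiff i (f - g) = pdiff i f - pdiff i g"
  by (rule poly_mapping_eqI) (simp add: lookup_pdiff lookup_minus right_diff_distrib)

lemma pdiff_sum: "pdiff i (\<Sum>x\<in>A. f x) = (\<Sum>x\<in>A. pdiff i (f x))"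
  by (induction A rule: infinite_finite_induct) (simp_all add: pdiff_add)

lemma pdiff_commute: "pdiff i (pdiff j f) = pdiff j (pdiff i f)"
proof (rule poly_mapping_eqI)
  show "Poly_Mapping.lookup (pdiff i (pdiff j f)) m = Poly_Mapping.lookup (pdiff j (pdiff i f)) m" for m
    by (cases "i = j") (auto simp: lookup_pdiff lookup_add lookup_single ac_simps)
qed

lemma pdiff_mult: "pdiff i (f * g) = pdiff i f * g + f * pdiff i g"
proof (induction f rule: mvpoly_induct)
  case (single m c)
  show ?case
  proof (induction g rule: mvpoly_induct)
    case (single n d)
    let ?e = "Poly_Mapping.single i (1::nat)"
    have 1: "m - ?e + n = m + n - ?e" if "Poly_Mapping.lookup m i \<noteq> 0"
      using that by (auto simp: poly_mapping_eq_iff fun_eq_iff lookup_add lookup_minus lookup_single when_def)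
    have 2: "m + (n - ?e) = m + n - ?e" if "Poly_Mapping.lookup n i \<noteq> 0"
      using that by (auto simp: poly_mapping_eq_iff fun_eq_iff lookup_add lookup_minus lookup_single when_def)
    have "Poly_Mapping.single (m - ?e + n) (of_nat (Poly_Mapping.lookup m i) * c * d) =
        Poly_Mapping.single (m + n - ?e) (of_nat (Poly_Mapping.lookup m i) * c * d)"
      using 1 by (cases "Poly_Mapping.lookup m i = 0") auto
    moreover have "Poly_Mapping.single (m + (n - ?e)) (c * (of_nat (Poly_Mapping.lookup n i) * d)) =
        Poly_Mapping.single (m + n - ?e) (c * (of_nat (Poly_Mapping.lookup n i) * d))"
      using 2 by (cases "Poly_Mapping.lookup n i = 0") auto
    ultimately show ?case
      by (simp add: pdiff_single mult_single lookup_add algebra_simps flip: single_add)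
  qed (simp add: pdiff_add algebra_simps)
qed (simp add: pdiff_add algebra_simps)

text \<open>In characteristic zero the factor \<open>of_nat (Poly_Mapping.lookup m i + 1)\<close>
  never vanishes. This criterion turns elimination of a variable into vanishing of a
  derivative.\<close>

lemma pdiff_eq_0_iff:
  fixes f :: "('n, 'k::{semiring_char_0, comm_semiring_1, semiring_no_zero_divisors}) mvpoly"
  shows "pdiff i f = 0 \<longleftrightarrow> i \<notin> mv_vars f"
proof
  assume "pdiff i f = 0"
  then have *: "Poly_Mapping.lookup f (m + Poly_Mapping.single i 1) = 0" for m
    using lookup_pdiff[of i f m] by (metis lookup_zero mult_eq_0_iff of_nat_eq_0_iff Suc_eq_plus1 nat.simps(3))
  show "i \<notin> mv_vars f"
  proof
    assume "i \<in> mv_vars f"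
    then obtain m where m: "Poly_Mapping.lookup f m \<noteq> 0" "Poly_Mapping.lookup m i \<noteq> 0"
      by (auto simp: mv_vars_def in_keys_iff)
    have "m = (m - Poly_Mapping.single i 1) + Poly_Mapping.single i 1"
      using m(2) by (auto simp: poly_mapping_eq_iff fun_eq_iff lookup_add lookup_minus lookup_single when_def)
    with * m(1) show False by metis
  qed
next
  assume "i \<notin> mv_vars f"
  moreover have "i \<in> Poly_Mapping.keys (m + Poly_Mapping.single i 1)" for m :: "'n \<Rightarrow>\<^sub>0 nat"
    by (simp add: in_keys_iff lookup_add)
  ultimately have "m + Poly_Mapping.single i 1 \<notin> Poly_Mapping.keys f" for m
    unfolding mv_vars_def by blast
  then have "Poly_Mapping.lookup f (m + Poly_Mapping.single i 1) = 0" for m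
    unfolding in_keys_iff by simp
  then show "pdiff i f = 0"
    by (intro poly_mapping_eqI) (simp add: lookup_pdiff)
qed

lemma homogeneous_pdiff:
  assumes "homogeneous d f"
  shows "homogeneous (d - 1) (pdiff i f)"
  unfolding homogeneous_def
proof
  fix m
  assume "m \<in> Poly_Mapping.keys (pdiff i f)"
  then have "m + Poly_Mapping.single i 1 \<in> Poly_Mapping.keys f"
    by (auto simp: in_keys_iff lookup_pdiff)
  with assms have "(\<Sum>j\<in>UNIV. Poly_Mapping.lookup (m + Poly_Mapping.single i 1) j) = d"
    by (simp add: homogeneous_def)
  then show "(\<Sum>j\<in>UNIV. Poly_Mapping.lookup m j) = d - 1"
    by (simp add: lookup_add sum.distrib lookup_single when_def)
qed

subsection \<open>Evaluation homomorphisms\<close>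

text \<open>Coefficients and variables may be sent to another ring. Evaluation at a point,
  restriction to a line and linear substitution are all instances, so the chain rule is proved only
  once.\<close>

definition insertion ::
  "('k \<Rightarrow> 'r) \<Rightarrow> ('n \<Rightarrow> 'r) \<Rightarrow> ('n::finite, 'k::zero) mvpoly \<Rightarrow> 'r::comm_semiring_1" where
  "insertion c \<sigma> f = (\<Sum>m\<in>Poly_Mapping.keys f.
     c (Poly_Mapping.lookup f m) * (\<Prod>i\<in>UNIV. \<sigma> i ^ Poly_Mapping.lookup m i))"

locale coefficient_hom =
  fixes c :: "'k::comm_ring_1 \<Rightarrow> 'r::comm_ring_1"
  assumes hom_add: "c (a + b) = c a + c b"
    and hom_mult: "c (a * b) = c a * c b"
    and hom_1: "c 1 = 1"
begin

lemma hom_0: "c 0 = 0"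
  using hom_add[of 0 0] by simp

lemma hom_of_nat: "c (of_nat n) = of_nat n"
  by (induction n) (simp_all add: hom_0 hom_1 hom_add)

lemma insertion_0 [simp]: "insertion c \<sigma> 0 = 0"
  by (simp add: insertion_def)

lemma insertion_single:
  "insertion c \<sigma> (Poly_Mapping.single m a) = c a * (\<Prod>i\<in>UNIV. \<sigma> i ^ Poly_Mapping.lookup m i)"
  by (simp add: insertion_def hom_0)

lemma insertion_add: "insertion c \<sigma> (f + g) = insertion c \<sigma> f + insertion c \<sigma> g"
  unfolding insertion_def by (rule mvpoly_sum_keys_add) (simp_all add: hom_0 hom_add distrib_right)

lemma insertion_diff: "insertion c \<sigma> (f - g) = insertion c \<sigma> f - insertion c \<sigma> g"
  using insertion_add[of \<sigma> "f - g" g] by (simp add: algebra_simps)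

lemma insertion_sum: "insertion c \<sigma> (\<Sum>x\<in>A. F x) = (\<Sum>x\<in>A. insertion c \<sigma> (F x))"
  by (induction A rule: infinite_finite_induct) (simp_all add: insertion_add)

lemma insertion_mult: "insertion c \<sigma> (f * g) = insertion c \<sigma> f * insertion c \<sigma> g"
proof (induction f rule: mvpoly_induct)
  case (single m a)
  show ?case
  proof (induction g rule: mvpoly_induct)
    case (single n b)
    show ?case
      by (simp add: mult_single insertion_single hom_mult lookup_add power_add prod.distrib ac_simps)
  qed (simp add: insertion_add algebra_simps)
qed (simp add: insertion_add algebra_simps)

lemma insertion_scale_homogeneous:
  assumes "homogeneous d f"
  shows "insertion c (\<lambda>i. s * \<sigma> i) f = s ^ d * insertion c \<sigma> f"
  unfolding insertion_def sum_distrib_left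
proof (rule sum.cong)
  fix m
  assume "m \<in> Poly_Mapping.keys f"
  with assms have d: "d = (\<Sum>i\<in>UNIV. Poly_Mapping.lookup m i)"
    by (simp add: homogeneous_def)
  show "c (Poly_Mapping.lookup f m) * (\<Prod>i\<in>UNIV. (s * \<sigma> i) ^ Poly_Mapping.lookup m i) =
      s ^ d * (c (Poly_Mapping.lookup f m) * (\<Prod>i\<in>UNIV. \<sigma> i ^ Poly_Mapping.lookup m i))"
    by (simp add: d power_mult_distrib prod.distrib power_sum ac_simps)
qed simp

end

section \<open>Derivations and the chain rule\<close>

locale derivation =
  fixes D :: "'r::comm_ring_1 \<Rightarrow> 'r"
  assumes D_add: "D (x + y) = D x + D y"
    and D_mult: "D (x * y) = D x * y + x * D y"
begin

lemma D_1: "D 1 = 0"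
  using D_mult[of 1 1] by simp

lemma D_power: "D (x ^ n) = of_nat n * x ^ (n - 1) * D x"
proof (induction n)
  case (Suc n)
  then show ?case
    by (cases n) (simp_all add: D_mult D_1 algebra_simps)
qed (simp add: D_1)

lemma D_prod:
  assumes "finite A"
  shows "D (\<Prod>x\<in>A. f x) = (\<Sum>x\<in>A. D (f x) * (\<Prod>y\<in>A - {x}. f y))"
  using assms
proof (induction A rule: finite_induct)
  case (insert a A)
  have "(\<Prod>y\<in>insert a A - {x}. f y) = f a * (\<Prod>y\<in>A - {x}. f y)" if "x \<in> A" for x
  proof -
    have "insert a A - {x} = insert a (A - {x})" using insert that by auto
    then show ?thesis using insert by simp
  qed
  then have "(\<Sum>x\<in>A. D (f x) * (\<Prod>y\<in>insert a A - {x}. f y)) = f a * (\<Sum>x\<in>A. D (f x) * (\<Prod>y\<in>A - {x}. f y))"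
    by (simp add: sum_distrib_left ac_simps)
  moreover have "insert a A - {a} = A" using insert by auto
  ultimately show ?case
    using insert by (simp add: D_mult)
qed (simp add: D_1)

end

text \<open>Both sides are additive in \<open>f\<close>, and on a monomial the claim is the Leibniz
  rule for a product of powers. It is applied with \<open>D\<close> being \<open>pderiv\<close> or
  \<open>pdiff j\<close>.\<close>

lemma insertion_chain_rule:
  fixes f :: "('n::finite, 'k::comm_ring_1) mvpoly" and \<sigma> :: "'n \<Rightarrow> 'r::comm_ring_1"
  assumes "coefficient_hom c" "derivation D" and const: "\<And>a. D (c a) = 0"
  shows "D (insertion c \<sigma> f) = (\<Sum>i\<in>UNIV. insertion c \<sigma> (pdiff i f) * D (\<sigma> i))"
proof -
  interpret coefficient_hom c by fact
  interpret derivation D by fact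
  show ?thesis
  proof (induction f rule: mvpoly_induct)
    case (single m a)
    let ?l = "Poly_Mapping.lookup m"
    have "insertion c \<sigma> (pdiff i (Poly_Mapping.single m a)) * D (\<sigma> i) =
       c a * (D (\<sigma> i ^ ?l i) * (\<Prod>j\<in>UNIV - {i}. \<sigma> j ^ ?l j))" for i
    proof -
      have "(\<Prod>j\<in>UNIV. \<sigma> j ^ Poly_Mapping.lookup (m - Poly_Mapping.single i 1) j) =
          \<sigma> i ^ (?l i - 1) * (\<Prod>j\<in>UNIV - {i}. \<sigma> j ^ ?l j)"
        by (subst prod.remove[of UNIV i]) (auto simp: lookup_minus lookup_single when_def intro!: prod.cong)
      then show ?thesis
        by (simp add: pdiff_single insertion_single hom_mult hom_of_nat D_power)
    qed
    then show ?case
      by (simp add: insertion_single D_mult const D_prod sum_distrib_left)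
  qed (simp add: insertion_add pdiff_add D_add sum.distrib distrib_right)
qed

lemma derivation_pdiff: "derivation (pdiff i :: ('n, 'k::comm_ring_1) mvpoly \<Rightarrow> _)"
  by unfold_locales (simp_all add: pdiff_add pdiff_mult)

lemma derivation_pderiv: "derivation (pderiv :: 'k::idom poly \<Rightarrow> _)"
  by unfold_locales (simp_all add: pderiv_add pderiv_mult)

text \<open>Compare the coefficients of \<open>t\<^sup>n\<close>: since \<open>\<delta>\<close> is a unit near \<open>0\<close>, they are determined by the lower ones.\<close>

lemma linear_ode_poly_eq_0:
  fixes y :: "'i::finite \<Rightarrow> 'k::field_char_0 poly"
  assumes ode: "\<And>l. \<delta> * pderiv (y l) = (\<Sum>j\<in>UNIV. M l j * y j)"
    and \<delta>: "poly \<delta> 0 \<noteq> 0" and init: "\<And>l. poly (y l) 0 = 0"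
  shows "y l = 0"
proof -
  have "coeff (y l) n = 0" for l n
  proof (induction n arbitrary: l rule: less_induct)
    case (less n)
    show ?case
    proof (cases n)
      case 0
      then show ?thesis using init by (simp add: poly_0_coeff_0)
    next
      case (Suc m)
      have "coeff (\<Sum>j\<in>UNIV. M l j * y j) m = 0"
        by (simp add: coeff_sum coeff_mult less Suc)
      moreover have "coeff (\<delta> * pderiv (y l)) m = (\<Sum>i\<in>{0}. coeff \<delta> i * coeff (pderiv (y l)) (m - i))"
        unfolding coeff_mult
        by (rule sum.mono_neutral_right) (auto simp: coeff_pderiv less Suc)
      ultimately have "coeff \<delta> 0 * (of_nat (Suc m) * coeff (y l) (Suc m)) = 0"
        by (simp add: ode coeff_pderiv)
      then show ?thesis
        using \<delta> by (simp add: Suc poly_0_coeff_0 del: of_nat_Suc)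
    qed
  qed
  then show ?thesis by (simp add: poly_eq_iff)
qed

subsection \<open>Evaluation at points and along lines\<close>

definition eval :: "'k::comm_ring_1 ^ 'n \<Rightarrow> ('n::finite, 'k) mvpoly \<Rightarrow> 'k" where
  "eval x = insertion (\<lambda>a. a) (($) x)"

definition restrict_line :: "'k::comm_ring_1 ^ 'n \<Rightarrow> 'k ^ 'n \<Rightarrow> ('n::finite, 'k) mvpoly \<Rightarrow> 'k poly" where
  "restrict_line x v = insertion (\<lambda>a. [:a:]) (\<lambda>i. [:x $ i, v $ i:])"

interpretation eval_hom: coefficient_hom "\<lambda>a. a"
  by unfold_locales auto

interpretation line_hom: coefficient_hom "\<lambda>a. [:a:]"
  by unfold_locales (auto simp: one_pCons)

lemma eval_0 [simp]: "eval x 0 = 0"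
  and eval_add: "eval x (f + g) = eval x f + eval x g"
  and eval_diff: "eval x (f - g) = eval x f - eval x g"
  and eval_mult: "eval x (f * g) = eval x f * eval x g"
  and eval_sum: "eval x (\<Sum>i\<in>A. F i) = (\<Sum>i\<in>A. eval x (F i))"
  unfolding eval_def
  by (simp_all only: eval_hom.insertion_0 eval_hom.insertion_add eval_hom.insertion_diff
      eval_hom.insertion_mult eval_hom.insertion_sum)

lemma eval_const [simp]: "eval x (mv_const a) = a"
  by (simp add: eval_def mv_const_def eval_hom.insertion_single)

lemma eval_scale_homogeneous:
  "homogeneous d f \<Longrightarrow> eval (s *s x) f = s ^ d * eval x f"
  using eval_hom.insertion_scale_homogeneous[of d f s "($) x"]
  by (simp add: eval_def vector_scalar_mult_def vec_lambda_inverse)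

lemma restrict_line_0 [simp]: "restrict_line x v 0 = 0"
  and restrict_line_add: "restrict_line x v (f + g) = restrict_line x v f + restrict_line x v g"
  and restrict_line_diff: "restrict_line x v (f - g) = restrict_line x v f - restrict_line x v g"
  and restrict_line_mult: "restrict_line x v (f * g) = restrict_line x v f * restrict_line x v g"
  unfolding restrict_line_def
  by (simp_all only: line_hom.insertion_0 line_hom.insertion_add line_hom.insertion_diff
      line_hom.insertion_mult)

lemma poly_restrict_line: "poly (restrict_line x v f) t = eval (x + t *s v) f"
  by (simp add: restrict_line_def eval_def insertion_def poly_sum poly_prod)

lemma pderiv_restrict_line:
  fixes f :: "('n::finite, 'k::idom) mvpoly"
  shows "pderiv (restrict_line x v f) = (\<Sum>i\<in>UNIV. smult (v $ i) (restrict_line x v (pdiff i f)))"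
  unfolding restrict_line_def
  by (subst insertion_chain_rule[OF line_hom.coefficient_hom_axioms derivation_pderiv])
     (simp_all add: pderiv_pCons)

text \<open>Euler's identity: on the line through the origin, \<open>f(tx)\<close> is the monomial
  \<open>t^d f(x)\<close>; differentiate it at \<open>t = 1\<close>.\<close>

lemma homogeneous_euler:
  fixes f :: "('n::finite, 'k::field_char_0) mvpoly"
  assumes "homogeneous d f"
  shows "(\<Sum>i\<in>UNIV. x $ i * eval x (pdiff i f)) = of_nat d * eval x f"
proof -
  have "restrict_line 0 x f = monom (eval x f) d"
    by (intro poly_eq_poly_eq_iff[THEN iffD1] ext)
       (simp add: poly_restrict_line eval_scale_homogeneous[OF assms] poly_monom)
  then have "poly (pderiv (restrict_line 0 x f)) 1 = of_nat d * eval x f"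
    by (simp add: pderiv_monom poly_monom)
  then show ?thesis
    by (simp add: pderiv_restrict_line poly_sum poly_restrict_line)
qed

text \<open>Induction on a bound for the total degree: restriction to coordinate lines shows that
  the partial derivatives vanish at all points too, so they are zero and \<open>f\<close> is
  constant.\<close>

lemma mvpoly_eq_0_if_eval_eq_0:
  fixes f :: "('n::finite, 'k::field_char_0) mvpoly"
  assumes "\<And>x. eval x f = 0"
  shows "f = 0"
proof -
  have "f = 0" if "\<forall>m\<in>Poly_Mapping.keys f. (\<Sum>i\<in>UNIV. Poly_Mapping.lookup m i) < N" "\<forall>x. eval x f = 0"
    for N and f :: "('n, 'k) mvpoly"
    using that
  proof (induction N arbitrary: f)
    case 0
    then show ?case by simp
  next
    case (Suc N)
    have "pdiff i f = 0" for i
    proof (rule Suc.IH)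
      show "\<forall>m\<in>Poly_Mapping.keys (pdiff i f). (\<Sum>i\<in>UNIV. Poly_Mapping.lookup m i) < N"
      proof
        fix m
        assume "m \<in> Poly_Mapping.keys (pdiff i f)"
        then have "m + Poly_Mapping.single i 1 \<in> Poly_Mapping.keys f"
          by (auto simp: in_keys_iff lookup_pdiff)
        with Suc.prems(1) have "(\<Sum>j\<in>UNIV. Poly_Mapping.lookup (m + Poly_Mapping.single i 1) j) < Suc N"
          by blast
        then show "(\<Sum>j\<in>UNIV. Poly_Mapping.lookup m j) < N"
          by (simp add: lookup_add sum.distrib lookup_single when_def)
      qed
      show "\<forall>x. eval x (pdiff i f) = 0"
      proof
        fix x
        have "restrict_line x (axis i 1) f = 0"
          using Suc.prems(2) by (simp add: poly_restrict_line flip: poly_all_0_iff_0)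
        then have "poly (pderiv (restrict_line x (axis i 1) f)) 0 = 0"
          by simp
        then show "eval x (pdiff i f) = 0"
          by (simp add: pderiv_restrict_line poly_sum poly_restrict_line axis_def if_distrib[of "\<lambda>a. a * _"] cong: if_cong)
      qed
    qed
    then have "mv_vars f = {}"
      by (auto simp: pdiff_eq_0_iff)
    then have "Poly_Mapping.keys f \<subseteq> {0}"
      by (auto simp: mv_vars_def)
    then have f: "f = mv_const (Poly_Mapping.lookup f 0)"
      by (intro poly_mapping_eqI) (auto simp: mv_const_def lookup_single when_def in_keys_iff)
    have "eval 0 f = 0"
      using Suc.prems by simp
    then have "Poly_Mapping.lookup f 0 = 0"
      by (subst (asm) f) simp
    with f show "f = 0"
      by (simp add: mv_const_def)
  qed
  moreover have "\<forall>m\<in>Poly_Mapping.keys f. (\<Sum>i\<in>UNIV. Poly_Mapping.lookup m i) <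
      Suc (\<Sum>m\<in>Poly_Mapping.keys f. \<Sum>i\<in>UNIV. Poly_Mapping.lookup m i)"
    by (auto simp only: less_Suc_eq_le finite_keys
        intro!: member_le_sum[where f = "\<lambda>m. \<Sum>i\<in>UNIV. Poly_Mapping.lookup m i"])
  ultimately show ?thesis
    using assms by blast
qed

subsection \<open>The gradient along the kernel of the Hessian\<close>

text \<open>With this, the indices of the nonvanishing principal minor can stay arbitrary; no
  renumbering of variables is needed.\<close>

lemma sum_UNIV_3_distinct:
  fixes i j k :: 3
  assumes "distinct [i, j, k]"
  shows "(\<Sum>l\<in>UNIV. F l) = F i + F j + F k"
  using assms exhaust_3[of i] exhaust_3[of j] exhaust_3[of k]
  by (auto simp: sum_3 ac_simps)

lemma exhaust_3_distinct:
  fixes i j k :: 3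
  assumes "distinct [i, j, k]"
  shows "l = i \<or> l = j \<or> l = k"
  using assms exhaust_3[of i] exhaust_3[of j] exhaust_3[of k] exhaust_3[of l]
  by auto

text \<open>Expansion along row \<open>k\<close>; the factors in parentheses form column
  \<open>k\<close> of the adjugate.\<close>

lemma det_symmetric_3:
  fixes H :: "'r::comm_ring_1 ^ 3 ^ 3"
  assumes "\<And>l m. H $ l $ m = H $ m $ l" and "distinct [i, j, k]"
  shows "det H = H$i$k * (H$i$j * H$j$k - H$i$k * H$j$j) + H$j$k * (H$i$j * H$i$k - H$i$i * H$j$k)
     + H$k$k * (H$i$i * H$j$j - H$i$j * H$i$j)"
  using assms(2) exhaust_3[of i] exhaust_3[of j] exhaust_3[of k]
    assms(1)[of 2 1] assms(1)[of 3 1] assms(1)[of 3 2]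
  by (auto simp: det_3 algebra_simps)

text \<open>
  Let \<open>H\<close> be a symmetric matrix with rows \<open>(a, b, p)\<close>, \<open>(b, e, q)\<close>, \<open>(p, q, r)\<close>, and let \<open>V\<close> be the last
  column of its adjugate, so that \<open>HV = (0, 0, det H)\<close>. The primed letters are derivatives in one
  direction, and \<open>det'\<close> is the derivative of \<open>det H = 0\<close>. The identity expresses \<open>V\<^sub>3 (u\<^sup>T H' u)\<close> linearly in the
  components of \<open>Hu\<close>: modulo these, \<open>V\<^sub>3 u\<close> equals \<open>u\<^sub>3 V\<close>, and \<open>H' V = - H V'\<close>.
\<close>

lemma kernel_flow_identity:
  fixes a b e p q r :: "'r::comm_ring_1"
  defines "V1 \<equiv> b * q - p * e" and "V2 \<equiv> b * p - a * q" and "V3 \<equiv> a * e - b * b"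
  assumes V1': "V1' = b' * q + b * q' - (p' * e + p * e')"
    and V2': "V2' = b' * p + b * p' - (a' * q + a * q')"
    and V3': "V3' = a' * e + a * e' - (b' * b + b * b')"
    and det': "(p' * V1 + p * V1') + (q' * V2 + q * V2') + (r' * V3 + r * V3') = 0"
    and A: "A = a' * u1 + b' * u2 + p' * u3" and B: "B = b' * u1 + e' * u2 + q' * u3"
    and C: "C = p' * u1 + q' * u2 + r' * u3"
  shows "V3 * (A * u1 + B * u2 + C * u3) =
     (e * A - b * B - u3 * V1') * (a * u1 + b * u2 + p * u3)
   + (a * B - b * A - u3 * V2') * (b * u1 + e * u2 + q * u3)
   + (- (u3 * V3')) * (p * u1 + q * u2 + r * u3)"
proof -
  have "V3 * (A * u1 + B * u2 + C * u3) -
     ((e * A - b * B - u3 * V1') * (a * u1 + b * u2 + p * u3)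
   + (a * B - b * A - u3 * V2') * (b * u1 + e * u2 + q * u3)
   + (- (u3 * V3')) * (p * u1 + q * u2 + r * u3)) =
   u3 * u3 * ((p' * V1 + p * V1') + (q' * V2 + q * V2') + (r' * V3 + r * V3'))"
    unfolding V1_def V2_def V3_def V1' V2' V3' A B C by (simp add: algebra_simps)
  then show ?thesis
    unfolding det' by simp
qed

text \<open>The minor, restricted to the line, is the leading coefficient \<open>\<delta>\<close> of
  the differential equation for \<open>y\<close>; it is nonzero at \<open>0\<close>, as
  \<open>linear_ode_poly_eq_0\<close> requires.\<close>

lemma gradient_constant_along_kernel:
  fixes f :: "(3, 'k::field_char_0) mvpoly"
  assumes det: "det (hessian f) = 0" and ijk: "distinct [i, j, k]"
    and minor: "eval x (pdiff i (pdiff i f) * pdiff j (pdiff j f) - pdiff i (pdiff j f) * pdiff i (pdiff j f)) \<noteq> 0"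
    and kernel: "\<And>l. (\<Sum>m\<in>UNIV. eval x (pdiff l (pdiff m f)) * v $ m) = 0"
  shows "eval (x + t *s v) (pdiff l f) = eval x (pdiff l f)"
proof -
  let ?\<phi> = "restrict_line x v"
  note ring_hom = restrict_line_add restrict_line_diff restrict_line_mult
  define h where "h l m = ?\<phi> (pdiff l (pdiff m f))" for l m
  define T where "T n l m = ?\<phi> (pdiff n (pdiff l (pdiff m f)))" for n l m
  define u where "u m = [:v $ m:]" for m
  define y where "y l = (\<Sum>m\<in>UNIV. h l m * u m)" for l
  note sum3 = sum_UNIV_3_distinct[OF ijk]
  have pderiv_line: "pderiv (?\<phi> g) = (\<Sum>m\<in>UNIV. ?\<phi> (pdiff m g) * u m)" for g
    by (simp add: pderiv_restrict_line u_def)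
  have h_commute: "h l m = h m l" for l m
    by (simp add: h_def pdiff_commute[of l m])
  have T_commute: "T n l m = T n m l" "T n l m = T l n m" for n l m
    unfolding T_def by (simp add: pdiff_commute[of l m], rule arg_cong[OF pdiff_commute])
  define \<delta> where "\<delta> = h i i * h j j - h i j * h i j"
  define V1' where "V1' n = T n i j * h j k + h i j * T n j k - (T n i k * h j j + h i k * T n j j)" for n
  define V2' where "V2' n = T n i j * h i k + h i j * T n i k - (T n i i * h j k + h i i * T n j k)" for n
  define V3' where "V3' n = T n i i * h j j + h i i * T n j j - (T n i j * h i j + h i j * T n i j)" for n
  define A where "A n = T n i i * u i + T n i j * u j + T n i k * u k" for n
  define B where "B n = T n i j * u i + T n j j * u j + T n j k * u k" for n
  define C where "C n = T n i k * u i + T n j k * u j + T n k k * u k" for n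
  \<comment> \<open>The coefficients of \<open>y i\<close>, \<open>y j\<close>, \<open>y k\<close>
    in \<open>kernel_flow_identity\<close>, with the primes denoting the derivative in direction
    \<open>n\<close>.\<close>
  define M where "M n m = (if m = i then h j j * A n - h i j * B n - u k * V1' n
    else if m = j then h i i * B n - h i j * A n - u k * V2' n else - (u k * V3' n))" for n m
  \<comment> \<open>The \<open>n\<close>-th partial derivative of the expanded determinant,
    restricted to the line.\<close>
  have det': "(T n i k * (h i j * h j k - h i k * h j j) + h i k * V1' n) +
      (T n j k * (h i j * h i k - h i i * h j k) + h j k * V2' n) +
      (T n k k * (h i i * h j j - h i j * h i j) + h k k * V3' n) = 0" for n
  proof -
    have "det (hessian f) = hessian f$i$k * (hessian f$i$j * hessian f$j$k - hessian f$i$k * hessian f$j$j)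
       + hessian f$j$k * (hessian f$i$j * hessian f$i$k - hessian f$i$i * hessian f$j$k)
       + hessian f$k$k * (hessian f$i$i * hessian f$j$j - hessian f$i$j * hessian f$i$j)"
      by (rule det_symmetric_3[OF _ ijk]) (simp add: hessian_def pdiff_commute)
    then have "?\<phi> (pdiff n (hessian f$i$k * (hessian f$i$j * hessian f$j$k - hessian f$i$k * hessian f$j$j)
       + hessian f$j$k * (hessian f$i$j * hessian f$i$k - hessian f$i$i * hessian f$j$k)
       + hessian f$k$k * (hessian f$i$i * hessian f$j$j - hessian f$i$j * hessian f$i$j))) = 0"
      by (simp add: det)
    then show ?thesis
      by (simp only: hessian_def vec_lambda_beta pdiff_add pdiff_diff pdiff_mult ring_hom
          h_def[symmetric] T_def[symmetric] V1'_def V2'_def V3'_def)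
  qed
  have "y n = 0" for n
  proof (rule linear_ode_poly_eq_0)
    show "poly \<delta> 0 \<noteq> 0"
      using minor by (simp add: \<delta>_def h_def poly_restrict_line eval_diff eval_mult)
    show "poly (y l) 0 = 0" for l
      using kernel[of l] by (simp add: y_def u_def h_def poly_sum poly_restrict_line mult.commute)
    show "\<delta> * pderiv (y n) = (\<Sum>m\<in>UNIV. M n m * y m)" for n
    proof -
      have pderiv_h: "pderiv (h l m) = T i l m * u i + T j l m * u j + T k l m * u k" for l m
        by (simp add: h_def T_def pderiv_line sum3)
      have pderiv_u: "pderiv (u m) = 0" for m
        by (simp add: u_def pderiv_pCons)
      \<comment> \<open>Since third derivatives are symmetric in all indices, the derivative of
        \<open>y n\<close> along \<open>v\<close> is the quadratic form of the \<open>n\<close>-th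
        derivative of the Hessian at \<open>u\<close>.\<close>
      have "pderiv (y n) = A n * u i + B n * u j + C n * u k"
        unfolding y_def sum3
        by (simp add: pderiv_add pderiv_mult pderiv_u pderiv_h A_def B_def C_def T_commute algebra_simps)
      then have "\<delta> * pderiv (y n) = \<delta> * (A n * u i + B n * u j + C n * u k)"
        by simp
      also have "\<dots> = (h j j * A n - h i j * B n - u k * V1' n) * (h i i * u i + h i j * u j + h i k * u k)
          + (h i i * B n - h i j * A n - u k * V2' n) * (h i j * u i + h j j * u j + h j k * u k)
          + (- (u k * V3' n)) * (h i k * u i + h j k * u j + h k k * u k)"
        unfolding \<delta>_def
        by (rule kernel_flow_identity[OF V1'_def V2'_def V3'_def det' A_def B_def C_def])
      also have "\<dots> = (\<Sum>m\<in>UNIV. M n m * y m)"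
      proof -
        have "M n i = h j j * A n - h i j * B n - u k * V1' n"
          "M n j = h i i * B n - h i j * A n - u k * V2' n" "M n k = - (u k * V3' n)"
          using ijk by (auto simp: M_def)
        then show ?thesis
          by (simp only: y_def sum3 h_commute[of j i] h_commute[of k i] h_commute[of k j])
      qed
      finally show ?thesis .
    qed
  qed
  moreover have "pderiv (?\<phi> (pdiff l f)) = y l"
    by (simp add: pderiv_line y_def h_def pdiff_commute[of l])
  ultimately obtain c where "?\<phi> (pdiff l f) = [:c:]"
    using pderiv_iszero by metis
  then have "poly (?\<phi> (pdiff l f)) t = poly (?\<phi> (pdiff l f)) 0"
    by simp
  then show ?thesis
    by (simp add: poly_restrict_line)
qed

lemma gradient_on_plane:
  fixes f :: "(3, 'k::field_char_0) mvpoly"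
  assumes det: "det (hessian f) = 0" and ijk: "distinct [i, j, k]"
    and minor: "eval x (pdiff i (pdiff i f) * pdiff j (pdiff j f) - pdiff i (pdiff j f) * pdiff i (pdiff j f)) \<noteq> 0"
    and kernel: "\<And>l. (\<Sum>m\<in>UNIV. eval x (pdiff l (pdiff m f)) * v $ m) = 0"
    and hom: "homogeneous d f"
  shows "eval (s *s x + t *s v) (pdiff l f) = s ^ (d - 1) * eval x (pdiff l f)"
proof -
  have nonzero: "eval (s *s x + t *s v) (pdiff l f) = s ^ (d - 1) * eval x (pdiff l f)" if "s \<noteq> 0" for s
  proof -
    have "s *s x + t *s v = s *s (x + (t / s) *s v)"
      using that by (simp add: vec_eq_iff field_simps)
    then show ?thesis
      by (simp only: eval_scale_homogeneous[OF homogeneous_pdiff[OF hom]]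
        gradient_constant_along_kernel[OF det ijk minor kernel])
  qed
  \<comment> \<open>Scaling by \<open>s\<close> needs \<open>s \<noteq> 0\<close>. The factor
    \<open>[:0, 1:]\<close> covers the missing point; cancelling it extends the identity to
    \<open>s = 0\<close>.\<close>
  have "poly ([:0, 1:] * (restrict_line (t *s v) x (pdiff l f) - monom (eval x (pdiff l f)) (d - 1))) z = 0" for z
    by (cases "z = 0") (simp_all add: poly_restrict_line poly_monom nonzero add.commute[of "t *s v"])
  then have "[:0, 1:] * (restrict_line (t *s v) x (pdiff l f) - monom (eval x (pdiff l f)) (d - 1)) = 0"
    using poly_all_0_iff_0 by blast
  then have "restrict_line (t *s v) x (pdiff l f) = monom (eval x (pdiff l f)) (d - 1)"
    by (simp del: mult_pCons_left)
  then have "poly (restrict_line (t *s v) x (pdiff l f)) s = poly (monom (eval x (pdiff l f)) (d - 1)) s"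
    by simp
  then show ?thesis
    by (simp add: poly_restrict_line poly_monom add.commute)
qed

text \<open>Euler's identity for the partial derivatives says that the Hessian maps \<open>x\<close>
  to \<open>d - 1\<close> times the gradient. By symmetry of the Hessian, pairing with a kernel
  vector gives zero, and \<open>d - 1\<close> is nonzero.\<close>

lemma gradient_orthogonal_kernel:
  fixes f :: "('n::finite, 'k::field_char_0) mvpoly"
  assumes hom: "homogeneous d f" and d: "d \<ge> 2"
    and kernel: "\<And>l. (\<Sum>m\<in>UNIV. eval x (pdiff l (pdiff m f)) * v $ m) = 0"
  shows "(\<Sum>m\<in>UNIV. v $ m * eval x (pdiff m f)) = 0"
proof -
  have "of_nat (d - 1) * (\<Sum>m\<in>UNIV. v $ m * eval x (pdiff m f)) =
      (\<Sum>m\<in>UNIV. v $ m * (\<Sum>l\<in>UNIV. x $ l * eval x (pdiff l (pdiff m f))))"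
    by (simp add: homogeneous_euler[OF homogeneous_pdiff[OF hom]] sum_distrib_left ac_simps)
  also have "\<dots> = (\<Sum>l\<in>UNIV. x $ l * (\<Sum>m\<in>UNIV. eval x (pdiff l (pdiff m f)) * v $ m))"
    unfolding sum_distrib_left by (subst sum.swap) (simp add: ac_simps)
  finally have "of_nat (d - 1) * (\<Sum>m\<in>UNIV. v $ m * eval x (pdiff m f)) = 0"
    by (simp add: kernel)
  then show ?thesis
    using d by (simp del: of_nat_diff)
qed

lemma four_vectors_dependent:
  fixes a b c e :: "'k::field ^ 3"
  obtains \<alpha> \<beta> \<gamma> \<epsilon> where "(\<alpha>, \<beta>, \<gamma>, \<epsilon>) \<noteq> (0, 0, 0, 0)" "\<alpha> *s a + \<beta> *s b = \<gamma> *s c + \<epsilon> *s e"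
proof -
  define w where "w = (\<lambda>m::4. if m = 1 then a else if m = 2 then b else if m = 3 then - c else - e)"
  \<comment> \<open>The columns are the four vectors, padded by a zero row that makes the matrix
    singular.\<close>
  define A :: "'k ^ 4 ^ 4" where "A = (\<chi> l m. if l = 4 then 0 else w m $ (if l = 1 then 1 else if l = 2 then 2 else 3))"
  have "row 4 A = 0"
    by (simp add: A_def row_def vec_eq_iff)
  then have "\<not> invertible A"
    by (simp add: invertible_det_nz det_zero_row(2))
  then obtain z where z: "A *v z = 0" "z \<noteq> 0"
    using matrix_left_invertible_ker[of A] invertible_left_inverse[of A] by blast
  show ?thesis
  proof (rule that[of "z $ 1" "z $ 2" "z $ 3" "z $ 4"])
    show "(z $ 1, z $ 2, z $ 3, z $ 4) \<noteq> (0, 0, 0, 0)"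
      using z(2) by (auto simp: vec_eq_iff forall_4)
    have *: "(A *v z) $ 1 = 0" "(A *v z) $ 2 = 0" "(A *v z) $ 3 = 0"
      using z(1) by simp_all
    have "a $ l * z $ 1 + b $ l * z $ 2 - c $ l * z $ 3 - e $ l * z $ 4 = 0" for l
      using * exhaust_3[of l] by (auto simp: matrix_vector_mult_def sum_4 A_def w_def)
    then show "z $ 1 *s a + z $ 2 *s b = z $ 3 *s c + z $ 4 *s e"
      by (simp add: vec_eq_iff diff_diff_eq ac_simps)
  qed
qed

lemma exists_eval_nonzero:
  fixes f :: "('n::finite, 'k::field_char_0) mvpoly"
  assumes "f \<noteq> 0"
  obtains x where "eval x f \<noteq> 0"
  using assms mvpoly_eq_0_if_eval_eq_0 by blast

subsection \<open>Parallel gradients\<close>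

definition gradient :: "('n::finite, 'k::comm_ring_1) mvpoly \<Rightarrow> 'k ^ 'n \<Rightarrow> 'k ^ 'n" where
  "gradient f x = (\<chi> l. eval x (pdiff l f))"

text \<open>Stated by vanishing minors, so the zero vector is parallel to everything; transitivity
  therefore needs a nonzero middle vector.\<close>

definition parallel :: "'k::comm_ring_1 ^ 'n \<Rightarrow> 'k ^ 'n \<Rightarrow> bool" where
  "parallel v w \<longleftrightarrow> (\<forall>l m. v $ l * w $ m = v $ m * w $ l)"

lemma not_parallel_combination_eq_0:
  fixes v w :: "'k::field ^ 'n"
  assumes "\<not> parallel v w" "s *s v = t *s w"
  shows "s = 0 \<and> t = 0"
proof -
  have eq: "s * v $ l = t * w $ l" for l
    using assms(2) by (simp add: vec_eq_iff)
  obtain l m where lm: "v $ l * w $ m \<noteq> v $ m * w $ l"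
    using assms(1) by (auto simp: parallel_def)
  have "s * (v $ l * w $ m - v $ m * w $ l) = s * v $ l * w $ m - s * v $ m * w $ l"
    by (simp add: algebra_simps)
  also have "\<dots> = 0"
    unfolding eq by (simp add: algebra_simps)
  finally have "s = 0"
    using lm by simp
  have "t * (v $ l * w $ m - v $ m * w $ l) = t * w $ m * v $ l - t * w $ l * v $ m"
    by (simp add: algebra_simps)
  also have "\<dots> = 0"
    unfolding eq[symmetric] by (simp add: algebra_simps)
  finally have "t = 0"
    using lm by simp
  with \<open>s = 0\<close> show ?thesis by simp
qed

lemma parallel_trans:
  fixes u v w :: "'k::field ^ 'n"
  assumes "parallel u w" "parallel v w" "w \<noteq> 0"
  shows "parallel u v"
proof -
  obtain n where n: "w $ n \<noteq> 0"
    using assms(3) by (auto simp: vec_eq_iff)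
  have u: "u $ l = u $ n / w $ n * w $ l" and v: "v $ l = v $ n / w $ n * w $ l" for l
    using assms(1,2) n by (auto simp: parallel_def field_simps)
  show ?thesis
    unfolding parallel_def by (subst (1 2) u, subst (1 2) v) (simp add: ac_simps)
qed

lemma parallel_commute: "parallel v w \<longleftrightarrow> parallel w v"
  by (auto simp: parallel_def mult.commute)

text \<open>The mixed minors have square zero, hence vanish in a domain; the remaining cases are
  symmetric variants.\<close>

lemma rank_one_if_principal_minors_eq_0:
  fixes h :: "3 \<Rightarrow> 3 \<Rightarrow> 'r::idom"
  assumes sym: "\<And>l m. h l m = h m l" and det: "det (\<chi> l m. h l m) = 0"
    and minors: "\<And>l m. h l l * h m m = h l m * h l m"
  shows "h a b * h c e = h a e * h c b"
proof -
  have off: "h i j * h i k = h i i * h j k" if ijk: "distinct [i, j, k]" for i j k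
  proof -
    have det_eq: "det (\<chi> l m. h l m) = h i k * (h i j * h j k - h i k * h j j) + h j k * (h i j * h i k - h i i * h j k)
     + h k k * (h i i * h j j - h i j * h i j)"
      using det_symmetric_3[of "\<chi> l m. h l m", OF _ ijk] sym by simp
    \<comment> \<open>Jacobi's identity for the \<open>2 \<times> 2\<close> minors of the adjugate\<close>
    have "(h i j * h i k - h i i * h j k) * (h i j * h i k - h i i * h j k) =
       (h i j * h i j - h i i * h j j) * (h i k * h i k - h i i * h k k) - h i i * det (\<chi> l m. h l m)"
      unfolding det_eq by (simp add: algebra_simps)
    also have "\<dots> = 0"
      by (simp add: det minors[of i j])
    finally show ?thesis by simp
  qed
  have sym': "h 2 1 = h 1 2" "h 3 1 = h 1 3" "h 3 2 = h 2 3"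
    by (rule sym)+
  have eqs: "h 1 1 * h 2 2 = h 1 2 * h 1 2" "h 1 1 * h 3 3 = h 1 3 * h 1 3" "h 2 2 * h 3 3 = h 2 3 * h 2 3"
    "h 1 2 * h 1 3 = h 1 1 * h 2 3" "h 1 2 * h 2 3 = h 2 2 * h 1 3" "h 1 3 * h 2 3 = h 3 3 * h 1 2"
    using minors off[of 1 2 3] off[of 2 1 3] off[of 3 1 2] by (simp_all add: sym')
  have eqs': "y * x = z" if "x * y = z" for x y z :: 'r
    using that by (simp add: mult.commute)
  show ?thesis
    using exhaust_3[of a] exhaust_3[of b] exhaust_3[of c] exhaust_3[of e]
    by (elim disjE; simp add: sym' eqs eqs[THEN eqs'] mult.commute)
qed

text \<open>Formally, quotients of two partial derivatives have zero derivative. To avoid division,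
  this is expressed by a differential equation on the line joining \<open>x\<close> to
  \<open>x'\<close>.\<close>

lemma gradients_parallel_if_rank_one:
  fixes f :: "('n::finite, 'k::field_char_0) mvpoly"
  assumes hom: "homogeneous d f" and d: "d \<ge> 2"
    and rank: "\<And>a b c e. pdiff a (pdiff b f) * pdiff c (pdiff e f) = pdiff a (pdiff e f) * pdiff c (pdiff b f)"
  shows "parallel (gradient f x) (gradient f x')"
proof -
  have log_derivative: "eval z (pdiff l f) * eval z (pdiff n (pdiff m f)) = eval z (pdiff m f) * eval z (pdiff n (pdiff l f))"
    for z l m n
  proof -
    have "of_nat (d - 1) * (eval z (pdiff l f) * eval z (pdiff n (pdiff m f))) =
        (\<Sum>i\<in>UNIV. z $ i * eval z (pdiff i (pdiff l f) * pdiff n (pdiff m f)))"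
      by (simp only: mult.assoc[symmetric] homogeneous_euler[OF homogeneous_pdiff[OF hom], symmetric]
          sum_distrib_right eval_mult)
    also have "\<dots> = (\<Sum>i\<in>UNIV. z $ i * eval z (pdiff i (pdiff m f) * pdiff n (pdiff l f)))"
      by (simp add: rank[of _ l n m])
    also have "\<dots> = of_nat (d - 1) * (eval z (pdiff m f) * eval z (pdiff n (pdiff l f)))"
      by (simp only: mult.assoc[symmetric] homogeneous_euler[OF homogeneous_pdiff[OF hom], symmetric]
          sum_distrib_right eval_mult)
    finally show ?thesis
      using d by (simp del: of_nat_diff)
  qed
  have "eval x (pdiff l f) * eval x' (pdiff m f) = eval x (pdiff m f) * eval x' (pdiff l f)" for l m
  proof -
    define p where "p n = restrict_line x (x' - x) (pdiff n f)" for n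
    have p0: "poly (p n) 0 = eval x (pdiff n f)" and p1: "poly (p n) 1 = eval x' (pdiff n f)" for n
      by (simp_all add: p_def poly_restrict_line)
    have p': "p l * pderiv (p m) = p m * pderiv (p l)" for l m
      by (intro poly_eq_poly_eq_iff[THEN iffD1] ext)
         (simp add: p_def pderiv_restrict_line poly_sum poly_restrict_line sum_distrib_left log_derivative mult.left_commute)
    \<comment> \<open>The equation for \<open>y\<close> needs a leading coefficient that is nonzero
      at \<open>0\<close>. If both partial derivatives vanish at \<open>x\<close>, both sides of the
      claim are zero.\<close>
    show ?thesis
    proof (cases "\<exists>n\<in>{l, m}. poly (p n) 0 \<noteq> 0")
      case True
      then obtain n where n: "n \<in> {l, m}" "poly (p n) 0 \<noteq> 0" by blast
      define y where "y = smult (poly (p l) 0) (p m) - smult (poly (p m) 0) (p l)"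
      have "p n * pderiv y = pderiv (p n) * y"
        using p'[of n l] p'[of n m]
        by (simp add: y_def pderiv_diff pderiv_smult right_diff_distrib mult.commute)
      moreover have "poly y 0 = 0"
        by (simp add: y_def mult.commute)
      ultimately have "y = 0"
        using linear_ode_poly_eq_0[of "p n" "\<lambda>_::unit. y" "\<lambda>_ _. pderiv (p n)"] n
        by (simp add: UNIV_unit)
      then have "poly y 1 = 0" by simp
      then show ?thesis
        by (simp add: y_def p0 p1)
    next
      case False
      then show ?thesis by (simp add: p0)
    qed
  qed
  then show ?thesis
    by (simp add: parallel_def gradient_def)
qed

lemma partials_dependent_if_parallel:
  fixes f :: "(3, 'k::field_char_0) mvpoly"
  assumes "\<And>x x'. parallel (gradient f x) (gradient f x')"
  obtains v :: "'k ^ 3" where "v \<noteq> 0" "(\<Sum>l\<in>UNIV. mv_const (v $ l) * pdiff l f) = 0"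
proof (cases "\<forall>x. gradient f x = 0")
  case True
  then have "(\<Sum>l\<in>UNIV. mv_const (axis 1 1 $ l) * pdiff l f) = 0"
    by (intro mvpoly_eq_0_if_eval_eq_0) (simp add: eval_sum eval_mult gradient_def vec_eq_iff)
  then show ?thesis
    by (intro that[of "axis 1 1"]) auto
next
  case False
  then obtain x' m where m: "gradient f x' $ m \<noteq> 0"
    by (auto simp: vec_eq_iff)
  obtain n where n: "n \<noteq> m"
    using exhaust_3[of m] by (metis that one_neq_zero zero_neq_one num1_eq1)
  define g where "g = gradient f x'"
  \<comment> \<open>Orthogonal to \<open>g\<close>, hence to every gradient, and nonzero because
    \<open>g $ m\<close> is.\<close>
  define v where "v = (\<chi> l. if l = n then g $ m else if l = m then - g $ n else 0)"
  have "v $ n \<noteq> 0" using m by (simp add: v_def g_def)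
  then have "v \<noteq> 0" by auto
  moreover have "(\<Sum>l\<in>UNIV. mv_const (v $ l) * pdiff l f) = 0"
  proof (rule mvpoly_eq_0_if_eval_eq_0)
    fix x
    have "(\<Sum>l\<in>UNIV. v $ l * gradient f x $ l) = (\<Sum>l\<in>{n, m}. v $ l * gradient f x $ l)"
      by (rule sum.mono_neutral_right) (auto simp: v_def)
    also have "\<dots> = 0"
      using n assms[of x x'] by (simp add: v_def g_def parallel_def mult.commute)
    finally show "eval x (\<Sum>l\<in>UNIV. mv_const (v $ l) * pdiff l f) = 0"
      by (simp add: eval_sum eval_mult gradient_def)
  qed
  ultimately show ?thesis by (rule that)
qed

lemma invertible_matrix_with_third_column:
  fixes v :: "'k::field ^ 3"
  assumes "v \<noteq> 0"
  obtains B :: "'k ^ 3 ^ 3" where "invertible B" "\<And>i. B $ i $ 3 = v $ i"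
proof -
  obtain k where k: "v $ k \<noteq> 0"
    using assms by (auto simp: vec_eq_iff)
  \<comment> \<open>Indices are added modulo 3: the first two columns are the unit vectors other
    than the \<open>k\<close>-th, so the determinant is \<open>v $ k\<close>.\<close>
  define B :: "'k ^ 3 ^ 3" where "B = (\<chi> i j. if j = 3 then v $ i else if i = k + j then 1 else 0)"
  have "det B \<noteq> 0"
    using k exhaust_3[of k] by (auto simp: B_def det_3)
  then show ?thesis
    by (intro that[of B]) (simp_all add: invertible_det_nz B_def)
qed

subsection \<open>Eliminating a variable\<close>

interpretation const_hom: coefficient_hom "mv_const :: 'k::comm_ring_1 \<Rightarrow> ('n, 'k) mvpoly"
  by unfold_locales (simp_all add: mv_const_def single_add mult_single)

text \<open>The chain rule: differentiating by the \<open>j\<close>-th variable amounts to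
  differentiating \<open>f\<close> in the direction of column \<open>j\<close> of
  \<open>B\<close>.\<close>

lemma pdiff_lin_subst:
  fixes f :: "('n::finite, 'k::comm_ring_1) mvpoly"
  shows "pdiff j (lin_subst f B) = lin_subst (\<Sum>i\<in>UNIV. mv_const (B $ i $ j) * pdiff i f) B"
proof -
  define \<sigma> where "\<sigma> i = (\<Sum>l\<in>UNIV. mv_const (B $ i $ l) * mv_var l :: ('n, 'k) mvpoly)" for i
  have lin_subst: "lin_subst g B = insertion mv_const \<sigma> g" for g :: "('n, 'k) mvpoly"
    by (simp add: lin_subst_def mv_subst_def insertion_def \<sigma>_def map_matrix_def matrix_vector_mult_def)
  have const: "pdiff j (mv_const a) = 0" for a :: 'k
    by (simp add: mv_const_def pdiff_single)
  have "pdiff j (mv_var l :: ('n, 'k) mvpoly) = (if l = j then 1 else 0)" for l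
    by (simp add: mv_var_def pdiff_single lookup_single when_def)
  then have \<sigma>': "pdiff j (\<sigma> i) = mv_const (B $ i $ j)" for i
    by (simp add: \<sigma>_def pdiff_sum pdiff_mult const if_distrib[of "\<lambda>a. _ * a"] cong: if_cong)
  have ins_const: "insertion mv_const \<sigma> (mv_const a) = mv_const a" for a :: 'k
    by (simp add: mv_const_def[of a] const_hom.insertion_single)
  show ?thesis
    unfolding lin_subst
    by (subst insertion_chain_rule[OF const_hom.coefficient_hom_axioms derivation_pdiff const])
       (simp add: \<sigma>' const_hom.insertion_sum const_hom.insertion_mult ins_const mult.commute)
qed

section \<open>Kernels of the Hessian and dependence of the partial derivatives\<close>

lemma hessian_kernel_vector:
  fixes f :: "(3, 'k::field_char_0) mvpoly"
  assumes det: "det (hessian f) = 0" and ijk: "distinct [i, j, k]"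
    and minor: "eval x (pdiff i (pdiff i f) * pdiff j (pdiff j f) - pdiff i (pdiff j f) * pdiff i (pdiff j f)) \<noteq> 0"
  obtains v :: "'k ^ 3" where "v \<noteq> 0" "\<And>l. (\<Sum>m\<in>UNIV. eval x (pdiff l (pdiff m f)) * v $ m) = 0"
proof -
  define h where "h l m = eval x (pdiff l (pdiff m f))" for l m
  have h_commute: "h l m = h m l" for l m
    by (simp add: h_def pdiff_commute[of l m])
  \<comment> \<open>Column \<open>k\<close> of the adjugate. Rows \<open>i\<close> and
    \<open>j\<close> of the Hessian annihilate it identically, row \<open>k\<close> gives the
    determinant, and its entry \<open>k\<close> is the nonzero minor.\<close>
  define v :: "'k ^ 3" where "v = (\<chi> l. if l = i then h i j * h j k - h i k * h j j
    else if l = j then h i j * h i k - h i i * h j k else h i i * h j j - h i j * h i j)"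
  have v: "v $ i = h i j * h j k - h i k * h j j" "v $ j = h i j * h i k - h i i * h j k"
      "v $ k = h i i * h j j - h i j * h i j"
    using ijk by (auto simp: v_def)
  have "det (hessian f) = hessian f$i$k * (hessian f$i$j * hessian f$j$k - hessian f$i$k * hessian f$j$j)
     + hessian f$j$k * (hessian f$i$j * hessian f$i$k - hessian f$i$i * hessian f$j$k)
     + hessian f$k$k * (hessian f$i$i * hessian f$j$j - hessian f$i$j * hessian f$i$j)"
    by (rule det_symmetric_3[OF _ ijk]) (simp add: hessian_def pdiff_commute)
  then have "eval x (hessian f$i$k * (hessian f$i$j * hessian f$j$k - hessian f$i$k * hessian f$j$j)
     + hessian f$j$k * (hessian f$i$j * hessian f$i$k - hessian f$i$i * hessian f$j$k)
     + hessian f$k$k * (hessian f$i$i * hessian f$j$j - hessian f$i$j * hessian f$i$j)) = 0"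
    by (simp add: det)
  then have k: "h i k * v $ i + h j k * v $ j + h k k * v $ k = 0"
    by (simp only: hessian_def vec_lambda_beta eval_add eval_diff eval_mult h_def[symmetric] v)
  show ?thesis
  proof (rule that)
    have "v $ k \<noteq> 0"
      using minor by (simp add: v h_def eval_diff eval_mult)
    then show "v \<noteq> 0" by auto
    show "(\<Sum>m\<in>UNIV. eval x (pdiff l (pdiff m f)) * v $ m) = 0" for l
      unfolding h_def[symmetric] sum_UNIV_3_distinct[OF ijk]
      using exhaust_3_distinct[OF ijk, of l]
    proof (elim disjE)
      assume "l = i"
      then show "h l i * v $ i + h l j * v $ j + h l k * v $ k = 0"
        by (simp add: v algebra_simps)
    next
      assume "l = j"
      then show "h l i * v $ i + h l j * v $ j + h l k * v $ k = 0"
        by (simp add: v h_commute[of j i] algebra_simps)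
    next
      assume "l = k"
      then show "h l i * v $ i + h l j * v $ j + h l k * v $ k = 0"
        using k by (simp add: h_commute[of k i] h_commute[of k j])
    qed
  qed
qed

lemma kernels_parallel:
  fixes f :: "(3, 'k::field_char_0) mvpoly"
  assumes hom: "homogeneous d f" and d: "d \<ge> 2" and det: "det (hessian f) = 0" and ijk: "distinct [i, j, k]"
  defines "D \<equiv> pdiff i (pdiff i f) * pdiff j (pdiff j f) - pdiff i (pdiff j f) * pdiff i (pdiff j f)"
  assumes x: "eval x D \<noteq> 0" and x': "eval x' D \<noteq> 0"
    and v: "\<And>l. (\<Sum>m\<in>UNIV. eval x (pdiff l (pdiff m f)) * v $ m) = 0"
    and v': "\<And>l. (\<Sum>m\<in>UNIV. eval x' (pdiff l (pdiff m f)) * v' $ m) = 0"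
    and gradients: "\<not> parallel (gradient f x) (gradient f x')"
  shows "parallel v v'"
proof -
  \<comment> \<open>A common vector of the planes spanned by \<open>x\<close>, \<open>v\<close> and
    by \<open>x'\<close>, \<open>v'\<close>; its gradient is computed from both sides.\<close>
  obtain s t s' t' where nontrivial: "(s, t, s', t') \<noteq> (0, 0, 0, 0)"
    and eq: "s *s x + t *s v = s' *s x' + t' *s v'"
    by (rule four_vectors_dependent)
  have "s ^ (d - 1) *s gradient f x = gradient f (s *s x + t *s v)"
    using gradient_on_plane[OF det ijk x[unfolded D_def] v hom]
    by (simp add: gradient_def vec_eq_iff)
  also have "\<dots> = s' ^ (d - 1) *s gradient f x'"
    unfolding eq using gradient_on_plane[OF det ijk x'[unfolded D_def] v' hom]
    by (simp add: gradient_def vec_eq_iff)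
  finally have "s ^ (d - 1) = 0 \<and> s' ^ (d - 1) = 0"
    by (rule not_parallel_combination_eq_0[OF gradients])
  then have s: "s = 0" "s' = 0" by simp_all
  \<comment> \<open>Only \<open>t\<close> and \<open>t'\<close> can be nonzero now, so this relation
    is nontrivial.\<close>
  with eq have "t *s v = t' *s v'" by simp
  with not_parallel_combination_eq_0[of v v' t t'] nontrivial s show ?thesis by auto
qed

lemma sum_mult_eq_0_if_parallel:
  fixes v w g :: "'k::field ^ 'n::finite"
  assumes "parallel v w" "w \<noteq> 0" "(\<Sum>l\<in>UNIV. w $ l * g $ l) = 0"
  shows "(\<Sum>l\<in>UNIV. v $ l * g $ l) = 0"
proof -
  obtain n where n: "w $ n \<noteq> 0"
    using assms(2) by (auto simp: vec_eq_iff)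
  have "w $ n * (\<Sum>l\<in>UNIV. v $ l * g $ l) = (\<Sum>l\<in>UNIV. v $ n * (w $ l * g $ l))"
    unfolding sum_distrib_left using assms(1)
    by (intro sum.cong) (simp_all add: parallel_def mult.assoc[symmetric] mult.commute[of "w $ n"])
  also have "\<dots> = 0"
    by (simp add: assms(3) flip: sum_distrib_left)
  finally show ?thesis using n by simp
qed

text \<open>Some minor \<open>p\<close> of the gradient and \<open>g\<close> is a nonzero
  polynomial, hence so is \<open>p * D\<close>. This moves a point to where \<open>D\<close> does
  not vanish.\<close>

lemma exists_not_parallel_gradient:
  fixes f D :: "(3, 'k::field_char_0) mvpoly"
  assumes D: "D \<noteq> 0" and g: "\<not> parallel (gradient f x') g"
  obtains x where "eval x D \<noteq> 0" "\<not> parallel (gradient f x) g"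
proof -
  obtain l m where lm: "gradient f x' $ l * g $ m \<noteq> gradient f x' $ m * g $ l"
    using g by (auto simp: parallel_def)
  define p where "p = pdiff l f * mv_const (g $ m) - pdiff m f * mv_const (g $ l)"
  have p: "eval x p = gradient f x $ l * g $ m - gradient f x $ m * g $ l" for x
    by (simp add: p_def eval_diff eval_mult gradient_def)
  have "eval x' p \<noteq> 0"
    using lm by (simp add: p)
  then have "p * D \<noteq> 0"
    using D by auto
  then obtain x where "eval x (p * D) \<noteq> 0"
    by (rule exists_eval_nonzero)
  then have "eval x D \<noteq> 0" "\<not> parallel (gradient f x) g"
    by (auto simp: eval_mult p parallel_def)
  then show ?thesis by (rule that)
qed

theorem partials_linearly_dependent:
  fixes f :: "(3, 'k::field_char_0) mvpoly"
  assumes hom: "homogeneous d f" and d: "d \<ge> 2" and det: "det (hessian f) = 0"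
  obtains v :: "'k ^ 3" where "v \<noteq> 0" "(\<Sum>l\<in>UNIV. mv_const (v $ l) * pdiff l f) = 0"
proof (cases "\<forall>x x'. parallel (gradient f x) (gradient f x')")
  case True
  then show ?thesis
    using partials_dependent_if_parallel that by blast
next
  case False
  define h where "h l m = pdiff l (pdiff m f)" for l m
  have "\<exists>l m. h l l * h m m \<noteq> h l m * h l m"
  proof (rule ccontr)
    assume "\<not> (\<exists>l m. h l l * h m m \<noteq> h l m * h l m)"
    moreover have "h l m = h m l" for l m
      by (simp add: h_def pdiff_commute[of l m])
    moreover have "det (\<chi> l m. h l m) = 0"
      using det by (simp add: hessian_def h_def)
    ultimately have "h a b * h c e = h a e * h c b" for a b c e
      by (intro rank_one_if_principal_minors_eq_0) auto
    then have "parallel (gradient f x) (gradient f x')" for x x'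
      unfolding h_def by (rule gradients_parallel_if_rank_one[OF hom d])
    with False show False by blast
  qed
  then obtain i j where ij: "h i i * h j j - h i j * h i j \<noteq> 0"
    by auto
  then have "i \<noteq> j" by auto
  have "{i, j} \<noteq> UNIV"
  proof
    assume "{i, j} = UNIV"
    then have "card {i, j} = CARD(3)" by simp
    then show False using \<open>i \<noteq> j\<close> by simp
  qed
  then obtain k where "k \<notin> {i, j}"
    by blast
  with \<open>i \<noteq> j\<close> have ijk: "distinct [i, j, k]"
    by auto
  define D where "D = pdiff i (pdiff i f) * pdiff j (pdiff j f) - pdiff i (pdiff j f) * pdiff i (pdiff j f)"
  have D: "D \<noteq> 0"
    using ij by (simp add: D_def h_def)
  obtain z1 z2 where "\<not> parallel (gradient f z1) (gradient f z2)"
    using False by blast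
  then obtain x1 where x1: "eval x1 D \<noteq> 0" "\<not> parallel (gradient f x1) (gradient f z2)"
    by (rule exists_not_parallel_gradient[OF D])
  then have "\<not> parallel (gradient f z2) (gradient f x1)"
    by (simp add: parallel_commute)
  then obtain x2 where x2: "eval x2 D \<noteq> 0" "\<not> parallel (gradient f x2) (gradient f x1)"
    by (rule exists_not_parallel_gradient[OF D])
  obtain v1 where v1: "v1 \<noteq> 0" "\<And>l. (\<Sum>m\<in>UNIV. eval x1 (pdiff l (pdiff m f)) * v1 $ m) = 0"
    using hessian_kernel_vector[OF det ijk x1(1)[unfolded D_def]] by blast
  obtain v2 where v2: "v2 \<noteq> 0" "\<And>l. (\<Sum>m\<in>UNIV. eval x2 (pdiff l (pdiff m f)) * v2 $ m) = 0"
    using hessian_kernel_vector[OF det ijk x2(1)[unfolded D_def]] by blast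
  note kernels = kernels_parallel[OF hom d det ijk, folded D_def]
  have v12: "parallel v1 v2"
    using kernels[OF x1(1) x2(1) v1(2) v2(2)] x2(2) parallel_commute by blast
  have orthogonal: "(\<Sum>l\<in>UNIV. v1 $ l * gradient f x $ l) = 0" if x: "eval x D \<noteq> 0" for x
  proof (cases "gradient f x = 0")
    case False
    obtain v where v: "v \<noteq> 0" "\<And>l. (\<Sum>m\<in>UNIV. eval x (pdiff l (pdiff m f)) * v $ m) = 0"
      using hessian_kernel_vector[OF det ijk x[unfolded D_def]] by blast
    \<comment> \<open>A nonzero gradient cannot be parallel to both of two gradients that are not
      parallel to each other.\<close>
    have "\<not> parallel (gradient f x1) (gradient f x) \<or> \<not> parallel (gradient f x2) (gradient f x)"
      using parallel_trans[of "gradient f x2" "gradient f x" "gradient f x1"] x2(2) False parallel_trans by blast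
    then have "parallel v1 v"
    proof
      assume "\<not> parallel (gradient f x1) (gradient f x)"
      then show ?thesis
        by (rule kernels[OF x1(1) x v1(2) v(2)])
    next
      assume "\<not> parallel (gradient f x2) (gradient f x)"
      then have "parallel v2 v"
        by (rule kernels[OF x2(1) x v2(2) v(2)])
      then show ?thesis
        using parallel_trans[OF v12 _ v2(1)] parallel_commute by blast
    qed
    moreover have "(\<Sum>l\<in>UNIV. v $ l * gradient f x $ l) = 0"
      using gradient_orthogonal_kernel[OF hom d v(2)] by (simp add: gradient_def)
    ultimately show ?thesis
      using sum_mult_eq_0_if_parallel v(1) by blast
  qed simp
  \<comment> \<open>Orthogonality is known only where \<open>D\<close> is nonzero; the factor
    \<open>D\<close> settles the other points and is then cancelled.\<close>
  have "(\<Sum>l\<in>UNIV. mv_const (v1 $ l) * pdiff l f) * D = 0"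
  proof (rule mvpoly_eq_0_if_eval_eq_0)
    show "eval x ((\<Sum>l\<in>UNIV. mv_const (v1 $ l) * pdiff l f) * D) = 0" for x
      using orthogonal[of x] by (cases "eval x D = 0") (auto simp: eval_mult eval_sum gradient_def)
  qed
  then have "(\<Sum>l\<in>UNIV. mv_const (v1 $ l) * pdiff l f) = 0"
    using D by simp
  then show ?thesis
    by (rule that[OF v1(1)])
qed

section \<open>The linear change of variables\<close>

theorem theorem5p3:
  fixes f :: "(3, 'k::{alg_closed_field, field_char_0}) mvpoly" and d :: nat
  assumes "homogeneous d f" and "d \<ge> 2"
    and "det (hessian f) = 0"
  shows "\<exists>A :: 'k ^ 3 ^ 3. invertible A \<and> mv_vars (lin_subst f (matrix_inv A)) \<subseteq> {1, 2}"
proof -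
  obtain v :: "'k ^ 3" where v: "v \<noteq> 0" "(\<Sum>l\<in>UNIV. mv_const (v $ l) * pdiff l f) = 0"
    using partials_linearly_dependent[OF assms] by blast
  obtain B :: "'k ^ 3 ^ 3" where B: "invertible B" "\<And>i. B $ i $ 3 = v $ i"
    using invertible_matrix_with_third_column[OF v(1)] by blast
  obtain A where A: "B ** A = mat 1" "A ** B = mat 1"
    using B(1) by (auto simp: invertible_def)
  have "pdiff 3 (lin_subst f B) = lin_subst 0 B"
    by (simp add: pdiff_lin_subst B(2) v(2))
  also have "\<dots> = 0"
    by (simp add: lin_subst_def mv_subst_def)
  finally have "3 \<notin> mv_vars (lin_subst f B)"
    by (simp add: pdiff_eq_0_iff)
  then have "mv_vars (lin_subst f B) \<subseteq> {1, 2}"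
    using exhaust_3 by blast
  moreover have "invertible A"
    using A by (auto simp: invertible_def)
  moreover have "matrix_inv A = B"
  proof -
    \<comment> \<open>\<open>matrix_inv\<close> is defined by choice; uniqueness of the two-sided
      inverse identifies it with \<open>B\<close>.\<close>
    have "A ** matrix_inv A = mat 1 \<and> matrix_inv A ** A = mat 1"
      unfolding matrix_inv_def
      by (rule someI[where P = "\<lambda>C. A ** C = mat 1 \<and> C ** A = mat 1" and x = B]) (simp add: A)
    then have "matrix_inv A ** A ** B = B"
      by simp
    then show ?thesis
      by (simp add: A flip: matrix_mul_assoc)
  qed
  ultimately show ?thesis by blast
qed

end
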